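(* Let $f$ be a size-$m$ $4$-hive, with vertices $P_1,P_2,P_3,P_4$ of $\Delta^4_m$ (where $P_a=m e_a$). Suppose the weight of the oriented edge $P_1\to P_2$ is $\omega_j$ or $\omega_j^*$ for some $1\le j\le m$, and the weight of the oriented edge $P_4\to P_3$ is $\omega_k$ or $\omega_k^*$ for some $1\le k\le m$. Let $\lambda$, $\mu$, $\nu$, $\rho$ be the weights of the oriented edges $P_2\to P_3$, $P_1\to P_4$, $P_1\to P_3$, $P_2\to P_4$ respectively. Then $$\rho=\mathrm{sort}(\lambda+\mu-\nu).$$
   Context: $\Delta^n_m=\{(i_1,\ldots,i_n)\in\mathbb{Z}_{\ge 0}^n:\sum i_j=m\}$, and $e_a$ is the $a$-th standard basis vector. A size-$m$ $3$-hive is an equivalence class, modulo adding constant functions, of functions $f:\Delta^3_m\to\mathbb{Z}$ satisfying, whenever all points involved lie in $\Delta^3_m$, the rhombus inequalities $f_{i,j,k}+f_{i,j+1,k-1}\ge f_{i+1,j,k-1}+f_{i-1,j+1,k}$, $f_{i,j,k}+f_{i+1,j-1,k}\ge f_{i+1,j,k-1}+f_{i,j-1,k+1}$, $f_{i,j,k}+f_{i+1,j,k-1}\ge f_{i,j+1,k-1}+f_{i+1,j-1,k}$. A size-$m$ $n$-hive is an equivalence class, modulo constants, of functions $f:\Delta^n_m\to\mathbb{Z}$ such that for all $a<b<c$ the restriction of $f$ to the face $\{i\in\Delta^n_m: i_d=0 \text{ for } d\notin\{a,b,c\}\}$ (with coordinates $(i_a,i_b,i_c)$) is a $3$-hive,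 and the octahedron recurrence holds: for every $i\in\mathbb{Z}_{\ge0}^n$ with $\sum i_j=m-2$ and all $1\le a<b<c<d\le n$, $f(i+e_a+e_c)+f(i+e_b+e_d)=\max\big(f(i+e_a+e_b)+f(i+e_c+e_d),\,f(i+e_a+e_d)+f(i+e_b+e_c)\big)$. For distinct $a,b$, let $x_t=(m-t)e_a+te_b$ ($0\le t\le m$); the weight of the oriented edge $P_a\to P_b$ is $(f(x_1)-f(x_0),\ldots,f(x_m)-f(x_{m-1}))$; it is a dominant weight of $GL_m$ (a weakly decreasing integer sequence), and reversing the orientation gives the dual weight $\mu^*=(-\mu_m,\ldots,-\mu_1)$. Minuscule weights: $\omega_i=(1^i,0^{m-i})$, $\omega_i^*=(0^{m-i},(-1)^i)$. $\mathrm{sort}(v)$ rearranges the entries of $v\in\mathbb{Z}^m$ in weakly decreasing order. *)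

theory Defs
  imports "HOL-Library.Poly_Mapping"
begin

text \<open>
  Points of \<open>\<int>\<^sub>\<ge>\<^sub>0\<^sup>n\<close> are finitely supported functions supported in \<open>{1..n}\<close>, so that they can be
  added and \<open>t e\<^sub>a\<close> is \<open>Poly_Mapping.single a t\<close>.
\<close>

type_synonym point = "nat \<Rightarrow>\<^sub>0 nat"

definition simplex_points :: "nat \<Rightarrow> nat \<Rightarrow> point set" where
  "simplex_points n m =
     {p. Poly_Mapping.keys p \<subseteq> {1..n} \<and> (\<Sum>j=1..n. Poly_Mapping.lookup p j) = m}"

abbreviation basis_vec :: "nat \<Rightarrow> point" where
  "basis_vec a \<equiv> Poly_Mapping.single a 1"

definition point3 :: "nat \<Rightarrow> nat \<Rightarrow> nat \<Rightarrow> point" where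
  "point3 i j k = Poly_Mapping.single 1 i + Poly_Mapping.single 2 j + Poly_Mapping.single 3 k"

text \<open>
  The guards on \<open>i\<close>, \<open>j\<close>, \<open>k\<close> say exactly that all four points of the rhombus lie in the
  simplex; they also make the truncated subtractions harmless.
\<close>

definition is_3hive :: "nat \<Rightarrow> (point \<Rightarrow> int) \<Rightarrow> bool" where
  "is_3hive m f \<longleftrightarrow>
     (\<forall>i j k. i + j + k = m \<longrightarrow>
        (i \<ge> 1 \<and> k \<ge> 1 \<longrightarrow>
           f (point3 i j k) + f (point3 i (j + 1) (k - 1))
             \<ge> f (point3 (i + 1) j (k - 1)) + f (point3 (i - 1) (j + 1) k)) \<and>
        (j \<ge> 1 \<and> k \<ge> 1 \<longrightarrow>
           f (point3 i j k) + f (point3 (i + 1) (j - 1) k)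
             \<ge> f (point3 (i + 1) j (k - 1)) + f (point3 i (j - 1) (k + 1))) \<and>
        (j \<ge> 1 \<and> k \<ge> 1 \<longrightarrow>
           f (point3 i j k) + f (point3 (i + 1) j (k - 1))
             \<ge> f (point3 i (j + 1) (k - 1)) + f (point3 (i + 1) (j - 1) k)))"

definition face :: "nat \<Rightarrow> nat \<Rightarrow> nat \<Rightarrow> (point \<Rightarrow> int) \<Rightarrow> point \<Rightarrow> int" where
  "face a b c f p =
     f (Poly_Mapping.single a (Poly_Mapping.lookup p 1) +
        Poly_Mapping.single b (Poly_Mapping.lookup p 2) +
        Poly_Mapping.single c (Poly_Mapping.lookup p 3))"

text \<open>
  The condition on a representative of an \<open>n\<close>-hive; it only involves the values of \<open>f\<close> on
  \<open>simplex_points n m\<close>.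
\<close>

definition is_hive :: "nat \<Rightarrow> nat \<Rightarrow> (point \<Rightarrow> int) \<Rightarrow> bool" where
  "is_hive n m f \<longleftrightarrow>
     (\<forall>a b c. 1 \<le> a \<and> a < b \<and> b < c \<and> c \<le> n \<longrightarrow> is_3hive m (face a b c f)) \<and>
     (\<forall>s i a b c d. s + 2 = m \<and> i \<in> simplex_points n s \<and>
         1 \<le> a \<and> a < b \<and> b < c \<and> c < d \<and> d \<le> n \<longrightarrow>
        f (i + basis_vec a + basis_vec c) + f (i + basis_vec b + basis_vec d) =
          max (f (i + basis_vec a + basis_vec b) + f (i + basis_vec c + basis_vec d))
              (f (i + basis_vec a + basis_vec d) + f (i + basis_vec b + basis_vec c)))"

text \<open>
  A function on \<open>simplex_points n m\<close> is represented by a total function with irrelevant values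
  elsewhere. Since only points of the simplex are compared, the quotient is that of functions
  on the simplex modulo constants.
\<close>

definition const_rel :: "nat \<Rightarrow> nat \<Rightarrow> ((point \<Rightarrow> int) \<times> (point \<Rightarrow> int)) set" where
  "const_rel n m = {(f, g). \<exists>c. \<forall>p\<in>simplex_points n m. g p = f p + c}"

definition hives :: "nat \<Rightarrow> nat \<Rightarrow> (point \<Rightarrow> int) set set" where
  "hives n m = {f. is_hive n m f} // const_rel n m"

definition edge_point :: "nat \<Rightarrow> nat \<Rightarrow> nat \<Rightarrow> nat \<Rightarrow> point" where
  "edge_point m a b t = Poly_Mapping.single a (m - t) + Poly_Mapping.single b t"

text \<open>Weights of \<open>GL\<^sub>m\<close> are integer lists of length \<open>m\<close>.\<close>

definition edge_weight :: "nat \<Rightarrow> (point \<Rightarrow> int) \<Rightarrow> nat \<Rightarrow> nat \<Rightarrow> int list" where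
  "edge_weight m f a b =
     map (\<lambda>t. f (edge_point m a b t) - f (edge_point m a b (t - 1))) [1..<m + 1]"

definition omega :: "nat \<Rightarrow> nat \<Rightarrow> int list" where
  "omega m i = replicate i 1 @ replicate (m - i) 0"

definition omega_dual :: "nat \<Rightarrow> nat \<Rightarrow> int list" where
  "omega_dual m i = replicate (m - i) 0 @ replicate i (- 1)"

definition sort_decreasing :: "int list \<Rightarrow> int list" where
  "sort_decreasing v = rev (sort v)"

definition weight_add :: "int list \<Rightarrow> int list \<Rightarrow> int list" where
  "weight_add = map2 (+)"

definition weight_diff :: "int list \<Rightarrow> int list \<Rightarrow> int list" where
  "weight_diff = map2 (-)"

text \<open>Hives and edge weights do not depend on the choice of representative.\<close>

lemma simplex_points_two:
  assumes "a \<in> {1..n}" "b \<in> {1..n}" "x + y = m"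
  shows "Poly_Mapping.single a x + Poly_Mapping.single b y \<in> simplex_points n m"
proof -
  have "Poly_Mapping.keys (Poly_Mapping.single a x + Poly_Mapping.single b y) \<subseteq> {1..n}"
    using assms keys_add[of "Poly_Mapping.single a x" "Poly_Mapping.single b y"]
    by (auto split: if_splits)
  then show ?thesis
    using assms
    by (simp add: simplex_points_def lookup_add lookup_single sum.distrib when_def)
qed

lemma simplex_points_add:
  assumes "p \<in> simplex_points n m" "q \<in> simplex_points n l"
  shows "p + q \<in> simplex_points n (m + l)"
  using assms keys_add[of p q]
  by (auto simp: simplex_points_def lookup_add sum.distrib)

lemma edge_weight_cong:
  assumes "(f, g) \<in> const_rel n m" "a \<in> {1..n}" "b \<in> {1..n}"
  shows "edge_weight m f a b = edge_weight m g a b"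
proof -
  from assms(1) obtain c where "\<forall>p\<in>simplex_points n m. g p = f p + c"
    by (auto simp: const_rel_def)
  then have "g (edge_point m a b t) = f (edge_point m a b t) + c" if "t \<le> m" for t
    using assms(2,3) that by (simp add: edge_point_def simplex_points_two)
  then show ?thesis
    by (auto simp: edge_weight_def)
qed

lemma is_hive_cong:
  assumes "(f, g) \<in> const_rel n m" "is_hive n m f"
  shows "is_hive n m g"
proof -
  from assms(1) obtain e where e: "\<And>p. p \<in> simplex_points n m \<Longrightarrow> g p = f p + e"
    by (auto simp: const_rel_def)
  have fc: "face a b c g (point3 i j k) = face a b c f (point3 i j k) + e"
    if "i + j + k = m" "1 \<le> a" "a < b" "b < c" "c \<le> n" for a b c i j k
  proof -
    have "Poly_Mapping.single a i + Poly_Mapping.single b j \<in> simplex_points n (i + j)"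
      using that by (intro simplex_points_two) auto
    moreover have "Poly_Mapping.single c k + Poly_Mapping.single c 0 \<in> simplex_points n k"
      using that by (intro simplex_points_two) auto
    ultimately have "Poly_Mapping.single a i + Poly_Mapping.single b j + Poly_Mapping.single c k
        \<in> simplex_points n m"
      using simplex_points_add that(1) by fastforce
    then show ?thesis
      by (simp add: face_def point3_def lookup_add lookup_single e)
  qed
  have oc: "g (i + basis_vec a + basis_vec b) = f (i + basis_vec a + basis_vec b) + e"
    if "s + 2 = m" "i \<in> simplex_points n s" "a \<in> {1..n}" "b \<in> {1..n}" for s i a b
  proof -
    have "i + (basis_vec a + basis_vec b) \<in> simplex_points n (s + 2)"
      using that by (intro simplex_points_add simplex_points_two) auto
    then show ?thesis
      using that(1) by (simp add: e add.assoc)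
  qed
  have "is_3hive m (face a b c g)" if "1 \<le> a" "a < b" "b < c" "c \<le> n" for a b c
  proof -
    have "is_3hive m (face a b c f)"
      using assms(2) that unfolding is_hive_def by blast
    then show ?thesis
      using that by (simp add: is_3hive_def fc)
  qed
  moreover have "g (i + basis_vec a + basis_vec c) + g (i + basis_vec b + basis_vec d) =
          max (g (i + basis_vec a + basis_vec b) + g (i + basis_vec c + basis_vec d))
              (g (i + basis_vec a + basis_vec d) + g (i + basis_vec b + basis_vec c))"
    if "s + 2 = m" "i \<in> simplex_points n s" "1 \<le> a" "a < b" "b < c" "c < d" "d \<le> n"
    for s i a b c d
  proof -
    have "f (i + basis_vec a + basis_vec c) + f (i + basis_vec b + basis_vec d) =
          max (f (i + basis_vec a + basis_vec b) + f (i + basis_vec c + basis_vec d))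
              (f (i + basis_vec a + basis_vec d) + f (i + basis_vec b + basis_vec c))"
      using assms(2) that unfolding is_hive_def by blast
    then show ?thesis
      using that oc[OF that(1,2)] by simp
  qed
  ultimately show ?thesis
    unfolding is_hive_def by blast
qed

end

(* Write G_s(x, y) = f(s - x, x, y, m - s - y). The octahedron recurrence relates the rectangular
   slices G_{s-1}, G_s, G_{s+1} and says that the mixed differences of G_s are of constant sign.
   The minuscule edges force all differences in x to take two consecutive values p, p + 1, and all
   differences in y two consecutive values q, q + 1. The corners of the slices give the weights:
   both mu - (lambda + mu - nu) and mu - rho take values in {p, p + 1}, and their partial sums
   differ by the total mixed difference of G_s. If that total is nonzero, the recurrence at the
   leftmost nonzero mixed difference, transported to the corner (0, 0), shows that mu does not jump
   at the corresponding place. Hence the two sequences have equal sums over every block on which mu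
   is constant, so that lambda + mu - nu and rho are rearrangements of each other. *)

theory Submission
  imports Defs "HOL-Library.Multiset"
begin

section \<open>Interlacing triangular arrays\<close>

text \<open>A Gelfand-Tsetlin pattern: row \<open>k\<close> consists of the \<open>m - k\<close>
  entries with \<open>k + j < m\<close>; values outside this triangle are unconstrained.\<close>

definition interlacing :: "nat \<Rightarrow> (nat \<Rightarrow> nat \<Rightarrow> int) \<Rightarrow> bool" where
  "interlacing m d \<longleftrightarrow>
     (\<forall>k j. k + j + 1 < m \<longrightarrow> d k (Suc j) \<le> d (Suc k) j \<and> d (Suc k) j \<le> d k j)"

lemma interlacingD:
  assumes "interlacing m d" "k + j + 1 < m"
  shows "d k (Suc j) \<le> d (Suc k) j" "d (Suc k) j \<le> d k j"
  using assms unfolding interlacing_def by blast+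

lemma interlacing_decreasing:
  assumes "interlacing m d" "k + j < m" "i \<le> j"
  shows "d k j \<le> d k i"
  using assms(3,2)
proof (induction j rule: dec_induct)
  case (step n)
  then show ?case
    using interlacingD[OF assms(1), of k n] by simp
qed simp

text \<open>Each entry is squeezed between two entries of the preceding row, so bounds on row 0
  spread to the whole triangle.\<close>

lemma interlacing_range:
  assumes "interlacing m d" and "\<And>j. j < m \<Longrightarrow> d 0 j \<in> {l..u}" and "k + j < m"
  shows "d k j \<in> {l..u}"
  using assms(3)
proof (induction k arbitrary: j)
  case 0
  then show ?case using assms(2) by simp
next
  case (Suc k j)
  show ?case
    using Suc.prems interlacingD[OF assms(1), of k j] Suc.IH[of j] Suc.IH[of "Suc j"] by simp
qed

text \<open>Row \<open>k\<close> without its first entry is dominated by row \<open>k + 1\<close>,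
  and without its last entry it dominates that row. So the drop of the row sums lies between the
  last and the first entry of row \<open>k\<close>.\<close>

lemma interlacing_sum_diff:
  assumes "interlacing m d" and "\<And>j. j < m \<Longrightarrow> d 0 j \<in> {l..u}" and "k < m"
  shows "(\<Sum>j<m - k. d k j) - (\<Sum>j<m - Suc k. d (Suc k) j) \<in> {l..u}"
proof -
  define n where "n = m - Suc k"
  have n: "m - k = Suc n" "k + n < m"
    using assms(3) by (auto simp: n_def)
  have "(\<Sum>j<n. d (Suc k) j) \<le> (\<Sum>j<n. d k j)"
    using interlacingD(2)[OF assms(1)] n by (intro sum_mono) auto
  moreover have "(\<Sum>j<n. d k (Suc j)) \<le> (\<Sum>j<n. d (Suc k) j)"
    using interlacingD(1)[OF assms(1)] n by (intro sum_mono) auto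
  moreover have "d k 0 \<in> {l..u}" "d k n \<in> {l..u}"
    using interlacing_range[OF assms(1,2)] n by auto
  moreover have "(\<Sum>j<Suc n. d k j) = d k 0 + (\<Sum>j<n. d k (Suc j))"
    by (rule sum.lessThan_Suc_shift)
  ultimately show ?thesis
    unfolding n(1) n_def[symmetric] by simp
qed

text \<open>Row \<open>k\<close> runs parallel to the edge from the first to the second vertex, at
  third coordinate \<open>k\<close>. The first rhombus inequality gives the upper bound, the third
  the lower one.\<close>

lemma is_3hive_rows:
  assumes "is_3hive m h"
  shows "interlacing m (\<lambda>k j. h (point3 (m - Suc (k + j)) (Suc j) k) - h (point3 (m - (k + j)) j k))"
  unfolding interlacing_def
proof (intro allI impI)
  fix k j assume "k + j + 1 < m"
  then obtain i where m: "m = i + j + k + 2"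
    using less_iff_Suc_add[of "k + j + 1" m] by (auto simp: algebra_simps)
  have "h (point3 (i + 1) j (k + 1)) + h (point3 (i + 1) (j + 1) k)
      \<ge> h (point3 (i + 2) j k) + h (point3 i (j + 1) (k + 1))"
    using assms[unfolded is_3hive_def, rule_format, of "i + 1" j "k + 1"] m by simp
  moreover have "h (point3 i (j + 1) (k + 1)) + h (point3 (i + 1) (j + 1) k)
      \<ge> h (point3 i (j + 2) k) + h (point3 (i + 1) j (k + 1))"
    using assms[unfolded is_3hive_def, rule_format, of i "j + 1" "k + 1"] m by simp
  moreover have "m - Suc (k + Suc j) = i" "m - (k + Suc j) = i + 1" "m - Suc (Suc k + j) = i"
      "m - (Suc k + j) = i + 1" "m - Suc (k + j) = i + 1" "m - (k + j) = i + 2"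
    using m by auto
  ultimately show "h (point3 (m - Suc (k + Suc j)) (Suc (Suc j)) k)
        - h (point3 (m - (k + Suc j)) (Suc j) k)
      \<le> h (point3 (m - Suc (Suc k + j)) (Suc j) (Suc k)) - h (point3 (m - (Suc k + j)) j (Suc k)) \<and>
      h (point3 (m - Suc (Suc k + j)) (Suc j) (Suc k)) - h (point3 (m - (Suc k + j)) j (Suc k))
      \<le> h (point3 (m - Suc (k + j)) (Suc j) k) - h (point3 (m - (k + j)) j k)"
    by simp
qed

text \<open>The analogue for the edge from the third to the second vertex, with the second rhombus
  inequality in place of the first.\<close>

lemma is_3hive_columns:
  assumes "is_3hive m h"
  shows "interlacing m (\<lambda>i j. h (point3 i (Suc j) (m - Suc (i + j))) - h (point3 i j (m - (i + j))))"
  unfolding interlacing_def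
proof (intro allI impI)
  fix i j assume "i + j + 1 < m"
  then obtain k where m: "m = i + j + k + 2"
    using less_iff_Suc_add[of "i + j + 1" m] by (auto simp: algebra_simps)
  have "h (point3 i (j + 1) (k + 1)) + h (point3 (i + 1) j (k + 1))
      \<ge> h (point3 (i + 1) (j + 1) k) + h (point3 i j (k + 2))"
    using assms[unfolded is_3hive_def, rule_format, of i "j + 1" "k + 1"] m by simp
  moreover have "h (point3 i (j + 1) (k + 1)) + h (point3 (i + 1) (j + 1) k)
      \<ge> h (point3 i (j + 2) k) + h (point3 (i + 1) j (k + 1))"
    using assms[unfolded is_3hive_def, rule_format, of i "j + 1" "k + 1"] m by simp
  moreover have "m - Suc (i + Suc j) = k" "m - (i + Suc j) = k + 1" "m - Suc (Suc i + j) = k"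
      "m - (Suc i + j) = k + 1" "m - Suc (i + j) = k + 1" "m - (i + j) = k + 2"
    using m by auto
  ultimately show "h (point3 i (Suc (Suc j)) (m - Suc (i + Suc j)))
        - h (point3 i (Suc j) (m - (i + Suc j)))
      \<le> h (point3 (Suc i) (Suc j) (m - Suc (Suc i + j))) - h (point3 (Suc i) j (m - (Suc i + j))) \<and>
      h (point3 (Suc i) (Suc j) (m - Suc (Suc i + j))) - h (point3 (Suc i) j (m - (Suc i + j)))
      \<le> h (point3 i (Suc j) (m - Suc (i + j))) - h (point3 i j (m - (i + j)))"
    by simp
qed

text \<open>In the sum of two rhombus inequalities the values off the edge cancel. This is why edge
  weights decrease.\<close>

lemma is_3hive_concave:
  assumes "is_3hive m h" "i + k + 2 = m"
  shows "h (point3 (i + 2) 0 k) + h (point3 i 0 (k + 2)) \<le> 2 * h (point3 (i + 1) 0 (k + 1))"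
proof -
  have "h (point3 (i + 1) 0 (k + 1)) + h (point3 (i + 1) 1 k)
      \<ge> h (point3 (i + 2) 0 k) + h (point3 i 1 (k + 1))"
    using assms(1)[unfolded is_3hive_def, rule_format, of "i + 1" 0 "k + 1"] assms(2) by simp
  moreover have "h (point3 i 1 (k + 1)) + h (point3 (i + 1) 0 (k + 1))
      \<ge> h (point3 (i + 1) 1 k) + h (point3 i 0 (k + 2))"
    using assms(1)[unfolded is_3hive_def, rule_format, of i 1 "k + 1"] assms(2) by simp
  ultimately show ?thesis
    by simp
qed

section \<open>Slices of a 4-hive\<close>

definition point4 :: "nat \<Rightarrow> nat \<Rightarrow> nat \<Rightarrow> nat \<Rightarrow> point" where
  "point4 a b c d = Poly_Mapping.single 1 a + Poly_Mapping.single 2 b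
     + Poly_Mapping.single 3 c + Poly_Mapping.single 4 d"

lemma face_point3:
  "face 1 2 3 f (point3 i j k) = f (point4 i j k 0)"
  "face 1 2 4 f (point3 i j k) = f (point4 i j 0 k)"
  "face 1 3 4 f (point3 i j k) = f (point4 i 0 j k)"
  "face 2 3 4 f (point3 i j k) = f (point4 0 i j k)"
  by (simp_all add: face_def point3_def point4_def lookup_add lookup_single)

lemma edge_point_point4:
  "edge_point m 1 2 t = point4 (m - t) t 0 0"
  "edge_point m 4 3 t = point4 0 0 t (m - t)"
  "edge_point m 2 3 t = point4 0 (m - t) t 0"
  "edge_point m 1 4 t = point4 (m - t) 0 0 t"
  "edge_point m 1 3 t = point4 (m - t) 0 t 0"
  "edge_point m 2 4 t = point4 0 (m - t) 0 t"
  by (simp_all add: edge_point_def point4_def add.commute)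

lemma point4_in_simplex: "point4 a b c d \<in> simplex_points 4 (a + b + c + d)"
proof -
  have "(Poly_Mapping.single 1 a + Poly_Mapping.single 2 b)
      + (Poly_Mapping.single 3 c + Poly_Mapping.single 4 d) \<in> simplex_points 4 ((a + b) + (c + d))"
    by (intro simplex_points_add simplex_points_two) auto
  then show ?thesis
    by (simp add: point4_def add.assoc)
qed

lemma point4_add_basis_vec:
  "point4 a b c d + basis_vec 1 = point4 (Suc a) b c d"
  "point4 a b c d + basis_vec 2 = point4 a (Suc b) c d"
  "point4 a b c d + basis_vec 3 = point4 a b (Suc c) d"
  "point4 a b c d + basis_vec 4 = point4 a b c (Suc d)"
  by (rule poly_mapping_eqI, simp add: point4_def lookup_add lookup_single when_def)+

lemma is_hive_octahedron:
  assumes "is_hive 4 m f" "a + b + c + d + 2 = m"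
  shows "f (point4 (Suc a) b (Suc c) d) + f (point4 a (Suc b) c (Suc d)) =
    max (f (point4 (Suc a) (Suc b) c d) + f (point4 a b (Suc c) (Suc d)))
        (f (point4 (Suc a) b c (Suc d)) + f (point4 a (Suc b) (Suc c) d))"
proof -
  let ?i = "point4 a b c d"
  have "f (?i + basis_vec 1 + basis_vec 3) + f (?i + basis_vec 2 + basis_vec 4) =
    max (f (?i + basis_vec 1 + basis_vec 2) + f (?i + basis_vec 3 + basis_vec 4))
        (f (?i + basis_vec 1 + basis_vec 4) + f (?i + basis_vec 2 + basis_vec 3))"
    using assms(1)[unfolded is_hive_def, THEN conjunct2, rule_format,
        of "a + b + c + d" ?i 1 2 3 4] assms(2) point4_in_simplex
    by simp
  then show ?thesis
    unfolding point4_add_basis_vec .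
qed

text \<open>The plane where the first two coordinates sum to \<open>s\<close>, a rectangle with
  \<open>x \<le> s\<close> and \<open>y \<le> m - s\<close>. Its corners lie on the edges 1-4, 2-4,
  1-3 and 2-3.\<close>

definition slice :: "nat \<Rightarrow> (point \<Rightarrow> int) \<Rightarrow> nat \<Rightarrow> nat \<Rightarrow> nat \<Rightarrow> int" where
  "slice m f s x y = f (point4 (s - x) x y (m - s - y))"

text \<open>The parameters treat both kinds of minuscule weights at once: 0 stands for
  \<open>omega\<close>, -1 for \<open>omega_dual\<close>.\<close>

locale minuscule_4hive =
  fixes m :: nat and f :: "point \<Rightarrow> int" and p q :: int
  assumes hive: "is_hive 4 m f"
    and edge12: "\<And>t. t < m \<Longrightarrow> f (edge_point m 1 2 (Suc t)) - f (edge_point m 1 2 t) \<in> {p..p + 1}"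
    and edge43: "\<And>t. t < m \<Longrightarrow> f (edge_point m 4 3 (Suc t)) - f (edge_point m 4 3 t) \<in> {q..q + 1}"
begin

abbreviation G :: "nat \<Rightarrow> nat \<Rightarrow> nat \<Rightarrow> int" where
  "G \<equiv> slice m f"

text \<open>The second term of the maximum is the other diagonal of the same unit square. If the
  square has nonzero mixed difference, the first term, from the slices \<open>s + 1\<close> and
  \<open>s - 1\<close>, must attain the maximum.\<close>

lemma octahedron:
  assumes "x < s" "y < m - s"
  shows "G s (Suc x) y + G s x (Suc y) =
    max (G (Suc s) (Suc x) y + G (s - 1) x (Suc y)) (G s x y + G s (Suc x) (Suc y))"
proof -
  define a d where "a = s - Suc x" and "d = m - s - Suc y"
  have "a + x + y + d + 2 = m" and eq: "s - Suc x = a" "s - x = Suc a" "Suc s - Suc x = Suc a"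
      "s - 1 - x = a" "m - s - y = Suc d" "m - s - Suc y = d" "m - Suc s - y = d"
      "m - (s - 1) - Suc y = Suc d"
    using assms by (auto simp: a_def d_def)
  then show ?thesis
    using is_hive_octahedron[OF hive, of a x y d] unfolding slice_def eq by linarith
qed

lemma mixed_difference_nonneg:
  assumes "x < s" "y < m - s"
  shows "G s x y + G s (Suc x) (Suc y) \<le> G s (Suc x) y + G s x (Suc y)"
  using octahedron[OF assms] by simp

section \<open>The four boundary faces as Gelfand-Tsetlin patterns\<close>

definition row123 :: "nat \<Rightarrow> nat \<Rightarrow> int" where
  "row123 k j = f (point4 (m - Suc (k + j)) (Suc j) k 0) - f (point4 (m - (k + j)) j k 0)"

definition row124 :: "nat \<Rightarrow> nat \<Rightarrow> int" where
  "row124 k j = f (point4 (m - Suc (k + j)) (Suc j) 0 k) - f (point4 (m - (k + j)) j 0 k)"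

definition col134 :: "nat \<Rightarrow> nat \<Rightarrow> int" where
  "col134 i j = f (point4 i 0 (Suc j) (m - Suc (i + j))) - f (point4 i 0 j (m - (i + j)))"

definition col234 :: "nat \<Rightarrow> nat \<Rightarrow> int" where
  "col234 i j = f (point4 0 i (Suc j) (m - Suc (i + j))) - f (point4 0 i j (m - (i + j)))"

lemma face_is_3hive:
  assumes "1 \<le> a" "a < b" "b < c" "c \<le> 4"
  shows "is_3hive m (face a b c f)"
  using hive assms unfolding is_hive_def by blast

lemma interlacing_faces:
  "interlacing m row123" "interlacing m row124" "interlacing m col134" "interlacing m col234"
  using is_3hive_rows[OF face_is_3hive[of 1 2 3], unfolded face_point3]
    is_3hive_rows[OF face_is_3hive[of 1 2 4], unfolded face_point3]
    is_3hive_columns[OF face_is_3hive[of 1 3 4], unfolded face_point3]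
    is_3hive_columns[OF face_is_3hive[of 2 3 4], unfolded face_point3]
  by (simp_all add: row123_def[abs_def] row124_def[abs_def] col134_def[abs_def] col234_def[abs_def])

lemma faces_range_0:
  assumes "t < m"
  shows "row123 0 t \<in> {p..p + 1}" "row124 0 t \<in> {p..p + 1}"
    "col134 0 t \<in> {q..q + 1}" "col234 0 t \<in> {q..q + 1}"
  using edge12[OF assms, unfolded edge_point_point4] edge43[OF assms, unfolded edge_point_point4]
  by (simp_all add: row123_def row124_def col134_def col234_def)

lemma faces_range:
  assumes "k + j < m"
  shows "row123 k j \<in> {p..p + 1}" "row124 k j \<in> {p..p + 1}"
    "col134 k j \<in> {q..q + 1}" "col234 k j \<in> {q..q + 1}"
  using interlacing_range[OF interlacing_faces(1) faces_range_0(1) assms]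
    interlacing_range[OF interlacing_faces(2) faces_range_0(2) assms]
    interlacing_range[OF interlacing_faces(3) faces_range_0(3) assms]
    interlacing_range[OF interlacing_faces(4) faces_range_0(4) assms]
  by auto

text \<open>Each side of the rectangle lies on a face: the third, fourth, second and first
  coordinate vanishes for \<open>y = 0\<close>, \<open>y = m - s\<close>, \<open>x = 0\<close> and
  \<open>x = s\<close> respectively.\<close>

lemma slice_boundary:
  assumes "s \<le> m"
  shows "x < s \<Longrightarrow> G s (Suc x) 0 - G s x 0 = row124 (m - s) x"
    and "x < s \<Longrightarrow> G s (Suc x) (m - s) - G s x (m - s) = row123 (m - s) x"
    and "G s 0 (Suc y) - G s 0 y = col134 s y"
    and "G s s (Suc y) - G s s y = col234 s y"
proof -
  have "m - Suc (m - s + x) = s - Suc x" "m - (m - s + x) = s - x"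
    using assms by auto
  then show "x < s \<Longrightarrow> G s (Suc x) 0 - G s x 0 = row124 (m - s) x"
    and "x < s \<Longrightarrow> G s (Suc x) (m - s) - G s x (m - s) = row123 (m - s) x"
    by (simp_all add: slice_def row124_def row123_def)
  show "G s 0 (Suc y) - G s 0 y = col134 s y" "G s s (Suc y) - G s s y = col234 s y"
    by (simp_all add: slice_def col134_def col234_def)
qed

section \<open>Slopes inside a slice\<close>

lemma x_difference_antimono:
  assumes "x < s" "y \<le> y'" "y' \<le> m - s"
  shows "G s (Suc x) y' - G s x y' \<le> G s (Suc x) y - G s x y"
  using assms(2,3)
proof (induction y' rule: dec_induct)
  case (step n)
  then show ?case
    using mixed_difference_nonneg[OF assms(1), of n] by simp
qed simp

lemma y_difference_antimono:
  assumes "y < m - s" "x \<le> x'" "x' \<le> s"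
  shows "G s x' (Suc y) - G s x' y \<le> G s x (Suc y) - G s x y"
  using assms(2,3)
proof (induction x' rule: dec_induct)
  case (step n)
  then show ?case
    using mixed_difference_nonneg[OF _ assms(1), of n] by simp
qed simp

text \<open>By monotonicity in \<open>y\<close> the slope lies between its values on the sides
  \<open>y = 0\<close> and \<open>y = m - s\<close>, which the faces control.\<close>

lemma x_difference_range:
  assumes "x < s" "s \<le> m" "y \<le> m - s"
  shows "G s (Suc x) y - G s x y \<in> {p..p + 1}"
proof -
  have "row124 (m - s) x \<in> {p..p + 1}" "row123 (m - s) x \<in> {p..p + 1}"
    using faces_range assms by auto
  then show ?thesis
    using x_difference_antimono[of x s 0 y] x_difference_antimono[of x s y "m - s"]
      slice_boundary(1,2)[OF assms(2,1)] assms by simp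
qed

lemma y_difference_range:
  assumes "x \<le> s" "s \<le> m" "y < m - s"
  shows "G s x (Suc y) - G s x y \<in> {q..q + 1}"
proof -
  have "col134 s y \<in> {q..q + 1}" "col234 s y \<in> {q..q + 1}"
    using faces_range assms by auto
  then show ?thesis
    using y_difference_antimono[of y s 0 x] y_difference_antimono[of y s x s]
      slice_boundary(3,4)[OF assms(2)] assms by simp
qed

text \<open>The second difference \<open>?h\<close> across slices is nonnegative at a square with
  nonzero mixed difference. On the way back to the corner the slopes of slice \<open>s\<close> are
  maximal, so \<open>?h\<close> cannot decrease.\<close>

lemma no_jump_at_corner:
  assumes s: "0 < s" "s < m"
    and ne: "G s s 0 + G s 0 (m - s) \<noteq> G s 0 0 + G s s (m - s)"
  shows "2 * G s 0 0 \<le> G (Suc s) 0 0 + G (s - 1) 0 0"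
proof -
  let ?D = "\<lambda>x y. G s (Suc x) y - G s x y"
  let ?h = "\<lambda>x y. G (Suc s) x y + G (s - 1) x y - 2 * G s x y"
  \<comment> \<open>\<open>P x\<close> says that the strip of squares between \<open>x\<close> and
    \<open>x + 1\<close> has nonzero total mixed difference.\<close>
  define P where "P x \<longleftrightarrow> x < s \<and> ?D x (m - s) < ?D x 0" for x
  have "\<exists>x. P x"
  proof (rule ccontr)
    assume "\<nexists>x. P x"
    then have "?D x (m - s) = ?D x 0" if "x < s" for x
      using that x_difference_antimono[of x s 0 "m - s"] by (force simp: P_def)
    then have "(\<Sum>x<s. ?D x (m - s)) = (\<Sum>x<s. ?D x 0)"
      by simp
    then show False
      using ne sum_lessThan_telescope[of "\<lambda>x. G s x 0" s]
        sum_lessThan_telescope[of "\<lambda>x. G s x (m - s)" s] by simp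
  qed
  define x where "x = (LEAST x. P x)"
  have "P x" and least: "\<And>x'. x' < x \<Longrightarrow> \<not> P x'"
    unfolding x_def using \<open>\<exists>x. P x\<close> by (auto intro: LeastI_ex dest: not_less_Least)
  then have x: "x < s" "?D x (m - s) < ?D x 0"
    by (auto simp: P_def)
  \<comment> \<open>Left of \<open>x\<close> the slope on \<open>y = 0\<close> is already
    \<open>p + 1\<close>, since it decreases in \<open>x\<close> and still exceeds \<open>p\<close>
    at \<open>x\<close>. By minimality of \<open>x\<close> it does not drop along any of these
    strips.\<close>
  have x_slope: "?D x' y = p + 1" if "x' < x" "y \<le> m - s" for x' y
  proof -
    have "?D x 0 \<le> ?D x' 0"
      using slice_boundary(1)[of s] interlacing_decreasing[OF interlacing_faces(2), of "m - s" x x']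
        that s x by simp
    then have "p + 1 \<le> ?D x' 0"
      using x x_difference_range[of x s "m - s"] s by simp
    also have "\<dots> \<le> ?D x' (m - s)"
      using least[OF that(1)] that x by (simp add: P_def)
    also have "\<dots> \<le> ?D x' y"
      using x_difference_antimono[of x' s y "m - s"] that x by simp
    finally show ?thesis
      using x_difference_range[of x' s y] that x s by simp
  qed
  obtain y where y: "y < m - s" "?D x (Suc y) < ?D x y"
  proof -
    have "\<not> ?D x 0 \<le> ?D x (m - s)"
      using x by simp
    moreover have "?D x 0 \<le> ?D x n" if "\<And>y. y < n \<Longrightarrow> ?D x y \<le> ?D x (Suc y)" for n
      using that by (induction n) fastforce+
    ultimately show thesis
      using that by (meson not_le)
  qed
  \<comment> \<open>A drop across the square at \<open>(x, y)\<close> forces the larger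
    \<open>y\<close>-slope to be \<open>q + 1\<close>. This value passes left to
    \<open>x = 0\<close> and then down to every \<open>y' \<le> y\<close>.\<close>
  have y_slope: "G s 0 (Suc y') - G s 0 y' = q + 1" if "y' \<le> y" for y'
  proof -
    have "q \<le> G s (Suc x) (Suc y) - G s (Suc x) y"
      using y_difference_range[of "Suc x" s y] s x y by simp
    also have "\<dots> < G s x (Suc y) - G s x y"
      using y by simp
    also have "\<dots> \<le> G s 0 (Suc y) - G s 0 y"
      using y_difference_antimono[of y s 0 x] x y by simp
    also have "\<dots> \<le> G s 0 (Suc y') - G s 0 y'"
      using slice_boundary(3)[of s] interlacing_decreasing[OF interlacing_faces(3), of s y y']
        that s y by simp
    finally show ?thesis
      using y_difference_range[of 0 s y'] that s y by simp
  qed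
  \<comment> \<open>The other term of the maximum is strictly smaller here by the choice of
    \<open>y\<close>.\<close>
  have "G s (Suc x) y + G s x (Suc y) = G (Suc s) (Suc x) y + G (s - 1) x (Suc y)"
    using octahedron[of x s y] x y by simp
  moreover have "G s (Suc x) y - G s x y = p + 1"
    using x_difference_range[of x s y] x_difference_range[of x s "Suc y"] x y s by simp
  moreover have "G s x (Suc y) - G s x y = q + 1"
    using y_difference_range[of x s y] y_difference_range[of "Suc x" s y] x y s by simp
  moreover have "G (Suc s) (Suc x) y - G (Suc s) x y \<le> p + 1"
    using x_difference_range[of x "Suc s" y] x y s by simp
  moreover have "G (s - 1) x (Suc y) - G (s - 1) x y \<le> q + 1"
    using y_difference_range[of x "s - 1" y] x y s by simp
  ultimately have "0 \<le> ?h x y"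
    by simp
  also have "?h x y \<le> ?h 0 y"
  proof -
    have "?h n y \<le> ?h 0 y" if "n \<le> x" for n
      using that
    proof (induction n)
      case (Suc n)
      have "G (Suc s) (Suc n) y - G (Suc s) n y \<le> p + 1"
        using x_difference_range[of n "Suc s" y] Suc.prems x y s by simp
      moreover have "G (s - 1) (Suc n) y - G (s - 1) n y \<le> p + 1"
        using x_difference_range[of n "s - 1" y] Suc.prems x y s by simp
      ultimately show ?case
        using Suc x_slope[of n y] y by simp
    qed simp
    then show ?thesis by simp
  qed
  also have "?h 0 y \<le> ?h 0 0"
  proof -
    have "?h 0 n \<le> ?h 0 0" if "n \<le> y" for n
      using that
    proof (induction n)
      case (Suc n)
      have "G (Suc s) 0 (Suc n) - G (Suc s) 0 n \<le> q + 1"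
        using y_difference_range[of 0 "Suc s" n] Suc.prems x y s by simp
      moreover have "G (s - 1) 0 (Suc n) - G (s - 1) 0 n \<le> q + 1"
        using y_difference_range[of 0 "s - 1" n] Suc.prems x y s by simp
      ultimately show ?case
        using Suc y_slope[of n] by simp
    qed simp
    then show ?thesis by simp
  qed
  finally show ?thesis by simp
qed

text \<open>The sums of row \<open>t\<close> of \<open>row123\<close> and \<open>row124\<close>
  telescope to the differences of corner values, so their drops are the entries of
  \<open>nu - lam\<close> and \<open>mu - rho\<close>.\<close>

lemma corner_differences_range:
  assumes "t < m"
  shows "(f (point4 0 (m - t) t 0) - f (point4 (m - t) 0 t 0))
      - (f (point4 0 (m - Suc t) (Suc t) 0) - f (point4 (m - Suc t) 0 (Suc t) 0)) \<in> {p..p + 1}"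
    and "(f (point4 0 (m - t) 0 t) - f (point4 (m - t) 0 0 t))
      - (f (point4 0 (m - Suc t) 0 (Suc t)) - f (point4 (m - Suc t) 0 0 (Suc t))) \<in> {p..p + 1}"
proof -
  have sum123: "(\<Sum>j<m - k. row123 k j) = f (point4 0 (m - k) k 0) - f (point4 (m - k) 0 k 0)"
    if "k \<le> m" for k
    using sum_lessThan_telescope[of "\<lambda>j. f (point4 (m - (k + j)) j k 0)" "m - k"] that
    by (simp add: row123_def)
  have sum124: "(\<Sum>j<m - k. row124 k j) = f (point4 0 (m - k) 0 k) - f (point4 (m - k) 0 0 k)"
    if "k \<le> m" for k
    using sum_lessThan_telescope[of "\<lambda>j. f (point4 (m - (k + j)) j 0 k)" "m - k"] that
    by (simp add: row124_def)
  show "(f (point4 0 (m - t) t 0) - f (point4 (m - t) 0 t 0))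
      - (f (point4 0 (m - Suc t) (Suc t) 0) - f (point4 (m - Suc t) 0 (Suc t) 0)) \<in> {p..p + 1}"
    using interlacing_sum_diff[OF interlacing_faces(1) faces_range_0(1) assms] assms sum123
    by simp
  show "(f (point4 0 (m - t) 0 t) - f (point4 (m - t) 0 0 t))
      - (f (point4 0 (m - Suc t) 0 (Suc t)) - f (point4 (m - Suc t) 0 0 (Suc t))) \<in> {p..p + 1}"
    using interlacing_sum_diff[OF interlacing_faces(2) faces_range_0(2) assms] assms sum124
    by simp
qed

text \<open>The total mixed difference of slice \<open>m - t\<close>, read off at its four
  corners.\<close>

definition excess :: "nat \<Rightarrow> int" where
  "excess t = f (edge_point m 1 3 t) + f (edge_point m 2 4 t)
     - f (edge_point m 2 3 t) - f (edge_point m 1 4 t)"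

text \<open>\<open>no_jump_at_corner\<close> gives convexity of \<open>f\<close> on the edge 1-4 at
  this point, and the face 1-2-4 gives concavity.\<close>

lemma weight14_constant:
  assumes "0 < t" "t < m" "excess t \<noteq> 0"
  shows "f (edge_point m 1 4 (Suc t)) - f (edge_point m 1 4 t)
    = f (edge_point m 1 4 t) - f (edge_point m 1 4 (t - 1))"
proof -
  define i k where "i = m - Suc t" and "k = t - 1"
  have eq: "m - Suc t = i" "m - t = Suc i" "m - (t - 1) = i + 2" "t = Suc k" "i + k + 2 = m"
    using assms by (auto simp: i_def k_def)
  have "2 * f (point4 (Suc i) 0 0 (Suc k)) \<le> f (point4 (i + 2) 0 0 k) + f (point4 i 0 0 (k + 2))"
    using no_jump_at_corner[of "m - t"] assms eq
    by (simp add: excess_def edge_point_point4[simplified] slice_def)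
  moreover have "f (point4 (i + 2) 0 0 k) + f (point4 i 0 0 (k + 2))
      \<le> 2 * f (point4 (Suc i) 0 0 (Suc k))"
    using is_3hive_concave[OF face_is_3hive[of 1 2 4] eq(5)] by (simp add: face_point3[simplified])
  ultimately show ?thesis
    unfolding edge_point_point4 eq(1-3) by (simp add: eq(4))
qed

lemma weight24_decreasing:
  assumes "0 < t" "t < m"
  shows "f (edge_point m 2 4 (Suc t)) - f (edge_point m 2 4 t)
    \<le> f (edge_point m 2 4 t) - f (edge_point m 2 4 (t - 1))"
proof -
  define i k where "i = m - Suc t" and "k = t - 1"
  have eq: "m - Suc t = i" "m - t = Suc i" "m - (t - 1) = i + 2" "t = Suc k" "i + k + 2 = m"
    using assms by (auto simp: i_def k_def)
  show ?thesis
    using is_3hive_concave[OF face_is_3hive[of 2 3 4] eq(5)]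
    unfolding edge_point_point4 eq(1-3) by (simp add: eq(4) face_point3[simplified])
qed

end

section \<open>Comparison of the weights\<close>

text \<open>\<open>A\<close> is the partial sum of \<open>\<epsilon> - \<epsilon>'\<close>. It
  vanishes wherever \<open>\<mu>\<close> changes, so on each run of constant \<open>\<mu>\<close>
  both sequences take the value \<open>p + 1\<close> equally often.\<close>

lemma mset_map_diff_eq:
  fixes \<mu> \<epsilon> \<epsilon>' A :: "nat \<Rightarrow> int"
  assumes range: "\<And>t. t < m \<Longrightarrow> \<epsilon> (Suc t) \<in> {p..p + 1} \<and> \<epsilon>' (Suc t) \<in> {p..p + 1}"
    and diff: "\<And>t. t < m \<Longrightarrow> \<epsilon> (Suc t) - \<epsilon>' (Suc t) = A (Suc t) - A t"
    and ends: "A 0 = 0" "A m = 0"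
    and const: "\<And>t. 0 < t \<Longrightarrow> t < m \<Longrightarrow> A t \<noteq> 0 \<Longrightarrow> \<mu> (Suc t) = \<mu> t"
  shows "mset (map (\<lambda>t. \<mu> t - \<epsilon> t) [1..<m + 1]) = mset (map (\<lambda>t. \<mu> t - \<epsilon>' t) [1..<m + 1])"
proof (rule multiset_eqI)
  fix z
  let ?c = "\<lambda>e n. int (count (mset (map (\<lambda>t. \<mu> t - e t) [1..<n + 1])) z)"
  \<comment> \<open>Within the current run, \<open>A n\<close> counts the surplus of
    \<open>p + 1\<close> in \<open>\<epsilon>\<close> over \<open>\<epsilon>'\<close>. Such entries
    produce \<open>z\<close> if \<open>\<mu> n = z + p + 1\<close> and fail to produce it if
    \<open>\<mu> n = z + p\<close>.\<close>
  have "?c \<epsilon> n - ?c \<epsilon>' n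
      = (if \<mu> n = z + p + 1 then A n else 0) - (if \<mu> n = z + p then A n else 0)"
    if "n \<le> m" for n
    using that
  proof (induction n)
    case 0
    then show ?case by (simp add: ends)
  next
    case (Suc n)
    have step: "?c e (Suc n) = ?c e n + (if \<mu> (Suc n) - e (Suc n) = z then 1 else 0)" for e
      by simp
    \<comment> \<open>For \<open>n = 0\<close> the value \<open>\<mu> 0\<close> is arbitrary, but
      \<open>A 0 = 0\<close>.\<close>
    have const': "A n = 0 \<or> \<mu> (Suc n) = \<mu> n"
      using Suc.prems const[of n] ends by (cases "n = 0") auto
    have "\<epsilon> (Suc n) = p \<or> \<epsilon> (Suc n) = p + 1" "\<epsilon>' (Suc n) = p \<or> \<epsilon>' (Suc n) = p + 1"
      using range[of n] Suc.prems by auto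
    then have new: "(if \<mu> (Suc n) - \<epsilon> (Suc n) = z then 1 else 0)
          - (if \<mu> (Suc n) - \<epsilon>' (Suc n) = z then 1 else 0)
        = (if \<mu> (Suc n) = z + p + 1 then \<epsilon> (Suc n) - \<epsilon>' (Suc n) else 0)
          - (if \<mu> (Suc n) = z + p then \<epsilon> (Suc n) - \<epsilon>' (Suc n) else 0)"
      by auto
    have diff': "\<epsilon> (Suc n) - \<epsilon>' (Suc n) = A (Suc n) - A n"
      using diff[of n] Suc.prems by simp
    have old: "?c \<epsilon> n - ?c \<epsilon>' n
        = (if \<mu> n = z + p + 1 then A n else 0) - (if \<mu> n = z + p then A n else 0)"
      using Suc.IH Suc.prems by linarith
    have "?c \<epsilon> (Suc n) - ?c \<epsilon>' (Suc n) = (?c \<epsilon> n - ?c \<epsilon>' n)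
        + ((if \<mu> (Suc n) - \<epsilon> (Suc n) = z then 1 else 0)
          - (if \<mu> (Suc n) - \<epsilon>' (Suc n) = z then 1 else 0))"
      unfolding step by simp
    also have "\<dots> = (if \<mu> (Suc n) = z + p + 1 then A (Suc n) else 0)
        - (if \<mu> (Suc n) = z + p then A (Suc n) else 0)"
      unfolding old new diff' using const' by auto
    finally show ?case .
  qed
  from this[of m] have "?c \<epsilon> m - ?c \<epsilon>' m = 0"
    by (simp only: ends order_refl if_cancel diff_self)
  then show "count (mset (map (\<lambda>t. \<mu> t - \<epsilon> t) [1..<m + 1])) z
      = count (mset (map (\<lambda>t. \<mu> t - \<epsilon>' t) [1..<m + 1])) z"
    by linarith
qed

lemma eq_sort_decreasing:
  assumes "sorted_wrt (\<ge>) xs" "mset xs = mset v"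
  shows "xs = sort_decreasing v"
proof -
  have "sort v = rev xs"
    using assms by (intro properties_for_sort) (simp_all add: sorted_wrt_rev)
  then show ?thesis
    by (simp add: sort_decreasing_def)
qed

lemma edge_weight_nth:
  assumes "t < m"
  shows "edge_weight m f a b ! t = f (edge_point m a b (Suc t)) - f (edge_point m a b t)"
  using assms by (simp add: edge_weight_def nth_append del: upt_Suc)

lemma length_edge_weight: "length (edge_weight m f a b) = m"
  by (simp add: edge_weight_def)

lemma minuscule_edge_range:
  assumes "\<exists>j. 1 \<le> j \<and> j \<le> m \<and> (edge_weight m f a b = omega m j \<or> edge_weight m f a b = omega_dual m j)"
  shows "\<exists>p. \<forall>t<m. f (edge_point m a b (Suc t)) - f (edge_point m a b t) \<in> {p..p + 1}"
proof -
  \<comment> \<open>The upper bounds stay unsimplified so that both cases are literal instances of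
    \<open>{p..p + 1}\<close>.\<close>
  have "set (edge_weight m f a b) \<subseteq> {0..0 + 1} \<or> set (edge_weight m f a b) \<subseteq> {-1..-1 + 1}"
    using assms by (auto simp: omega_def omega_dual_def)
  then obtain p where "set (edge_weight m f a b) \<subseteq> {p..p + 1}"
    by blast
  moreover have "edge_weight m f a b ! t \<in> set (edge_weight m f a b)" if "t < m" for t
    using that by (simp add: length_edge_weight)
  ultimately have "edge_weight m f a b ! t \<in> {p..p + 1}" if "t < m" for t
    using that by blast
  then show ?thesis
    by (metis edge_weight_nth)
qed

lemma (in minuscule_4hive) weight24_eq_sort:
  "edge_weight m f 2 4 = sort_decreasing
     (weight_diff (weight_add (edge_weight m f 2 3) (edge_weight m f 1 4)) (edge_weight m f 1 3))"
proof (rule eq_sort_decreasing)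
  show "sorted_wrt (\<ge>) (edge_weight m f 2 4)"
  proof (subst sorted_wrt_iff_nth_Suc_transp)
    show "\<forall>t. Suc t < length (edge_weight m f 2 4) \<longrightarrow>
        edge_weight m f 2 4 ! t \<ge> edge_weight m f 2 4 ! Suc t"
      using weight24_decreasing[of "Suc t" for t] by (simp add: length_edge_weight edge_weight_nth)
  qed simp
next
  let ?w = "\<lambda>a b t. f (edge_point m a b t) - f (edge_point m a b (t - 1))"
  \<comment> \<open>Both sides are put in the form \<open>\<mu> - \<epsilon>\<close>, with
    \<open>mu - rho\<close> and \<open>nu - lam\<close> as the two sequences; the left side is just
    \<open>rho\<close>.\<close>
  have "mset (map (\<lambda>t. ?w 1 4 t - (?w 1 4 t - ?w 2 4 t)) [1..<m + 1])
      = mset (map (\<lambda>t. ?w 1 4 t - (?w 1 3 t - ?w 2 3 t)) [1..<m + 1])"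
  proof (rule mset_map_diff_eq[where A = "\<lambda>t. - excess t"])
    fix t assume t: "t < m"
    show "?w 1 4 (Suc t) - ?w 2 4 (Suc t) \<in> {p..p + 1}
        \<and> ?w 1 3 (Suc t) - ?w 2 3 (Suc t) \<in> {p..p + 1}"
      using corner_differences_range[OF t] unfolding edge_point_point4 by simp
    show "?w 1 4 (Suc t) - ?w 2 4 (Suc t) - (?w 1 3 (Suc t) - ?w 2 3 (Suc t))
        = - excess (Suc t) - - excess t"
      by (simp add: excess_def)
  next
    \<comment> \<open>At both ends the four edge points coincide in pairs at vertices, so the terms
      cancel.\<close>
    show "- excess 0 = 0" "- excess m = 0"
      by (simp_all add: excess_def edge_point_def)
  next
    fix t assume "0 < t" "t < m" "- excess t \<noteq> 0"
    then show "?w 1 4 (Suc t) = ?w 1 4 t"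
      using weight14_constant[of t] by simp
  qed
  moreover have "weight_diff (weight_add (edge_weight m f 2 3) (edge_weight m f 1 4))
      (edge_weight m f 1 3) = map (\<lambda>t. ?w 1 4 t - (?w 1 3 t - ?w 2 3 t)) [1..<m + 1]"
    by (rule nth_equalityI)
      (simp_all add: weight_diff_def weight_add_def edge_weight_def del: upt_Suc)
  ultimately show "mset (edge_weight m f 2 4) = mset (weight_diff
      (weight_add (edge_weight m f 2 3) (edge_weight m f 1 4)) (edge_weight m f 1 3))"
    by (simp add: edge_weight_def)
qed

theorem theorem5p1:
  fixes m :: nat and H :: "(point \<Rightarrow> int) set" and f :: "point \<Rightarrow> int"
    and lam mu nu rho :: "int list"
  assumes "H \<in> hives 4 m" and "f \<in> H"
    and "\<exists>j. 1 \<le> j \<and> j \<le> m \<and> (edge_weight m f 1 2 = omega m j \<or> edge_weight m f 1 2 = omega_dual m j)"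
    and "\<exists>k. 1 \<le> k \<and> k \<le> m \<and> (edge_weight m f 4 3 = omega m k \<or> edge_weight m f 4 3 = omega_dual m k)"
    and "lam = edge_weight m f 2 3"
    and "mu = edge_weight m f 1 4"
    and "nu = edge_weight m f 1 3"
    and "rho = edge_weight m f 2 4"
  shows "rho = sort_decreasing (weight_diff (weight_add lam mu) nu)"
proof -
  \<comment> \<open>Membership in a class only relates \<open>f\<close> to some hive
    \<open>g\<close>; the hive conditions are then transferred to \<open>f\<close>.\<close>
  obtain g where "is_hive 4 m g" "(g, f) \<in> const_rel 4 m"
    using assms(1,2) by (auto simp: hives_def quotient_def)
  then have "is_hive 4 m f"
    by (rule is_hive_cong[rotated])
  moreover obtain p where
    "\<forall>t<m. f (edge_point m 1 2 (Suc t)) - f (edge_point m 1 2 t) \<in> {p..p + 1}"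
    using minuscule_edge_range[OF assms(3)] by blast
  moreover obtain q where
    "\<forall>t<m. f (edge_point m 4 3 (Suc t)) - f (edge_point m 4 3 t) \<in> {q..q + 1}"
    using minuscule_edge_range[OF assms(4)] by blast
  ultimately interpret minuscule_4hive m f p q
    by unfold_locales auto
  show ?thesis
    unfolding assms(5-8) by (rule weight24_eq_sort)
qed

end
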